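(* Consider a row of $n$ seats with a single entrance, filled by selfish theatregoers choosing seats according to the right-biased Zipf distribution (model described in the context). The expected number of occupied seats when the process ends is $\Theta(\ln^2 n)$ as $n\to\infty$.
   Context: Row model: a row of $n$ seats with a single entrance at one end. Theatregoers arrive one at a time; all are selfish: a seated theatregoer never gets up, so no later theatregoer can walk past her seat. An empty seat is accessible if it can be reached from the entrance without passing an occupied seat. When there are $m\ge1$ accessible empty seats, labelled $1,\dots,m$ in increasing order of distance from the entrance, the arriving theatregoer sits in the $k$-th one with probability $\frac{1}{(m+1-k)H_m}$, where $H_m=\sum_{i=1}^m\frac1i$ (right-biased Zipf distribution). The process ends when no accessible empty seat remains. *)

theory Defs
  imports "HOL-Probability.Probability" "HOL-Library.Landau_Symbols"
begin

text \<open>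
  The seats are \<open>1, \<dots>, n\<close>, seat \<open>i\<close> being the \<open>i\<close>-th one from the entrance.
  A state of the row is the set \<open>S\<close> of occupied seats.
\<close>

definition accessible :: "nat \<Rightarrow> nat set \<Rightarrow> nat set" where
  "accessible n S = {i \<in> {1..n}. i \<notin> S \<and> (\<forall>j \<in> S. \<not> j < i)}"

lemma finite_accessible [simp]: "finite (accessible n S)"
  by (simp add: accessible_def)

text \<open>Only meaningful for \<open>m \<ge> 1\<close>.\<close>

definition right_zipf :: "nat \<Rightarrow> nat pmf" where
  "right_zipf m =
     embed_pmf (\<lambda>k. if k \<in> {1..m} then 1 / ((real m + 1 - real k) * harm m) else 0)"

lemma right_zipf_sum:
  assumes "m \<ge> 1"
  shows "(\<Sum>k\<in>{1..m}. 1 / ((real m + 1 - real k) * harm m)) = 1"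
proof -
  have nz: "harm m \<noteq> (0::real)"
    using harm_pos[of m, where 'a = real] assms by linarith
  have "(\<Sum>k\<in>{1..m}. 1 / (real m + 1 - real k)) = (\<Sum>k\<in>{1..m}. 1 / real k)"
    by (rule sum.reindex_bij_witness[of _ "\<lambda>k. m + 1 - k" "\<lambda>k. m + 1 - k"])
       (auto simp: of_nat_diff)
  also have "\<dots> = harm m"
    by (simp add: harm_def inverse_eq_divide)
  finally have *: "(\<Sum>k\<in>{1..m}. 1 / (real m + 1 - real k)) = harm m" .
  have "(\<Sum>k\<in>{1..m}. 1 / ((real m + 1 - real k) * harm m)) =
          (\<Sum>k\<in>{1..m}. 1 / (real m + 1 - real k)) / harm m"
    by (simp add: sum_divide_distrib)
  then show ?thesis
    using * nz by simp
qed

lemma pmf_right_zipf: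
  assumes "m \<ge> 1"
  shows "pmf (right_zipf m) k =
           (if k \<in> {1..m} then 1 / ((real m + 1 - real k) * harm m) else 0)"
  unfolding right_zipf_def
proof (rule pmf_embed_pmf)
  let ?f = "\<lambda>k. if k \<in> {1..m} then 1 / ((real m + 1 - real k) * harm m) else 0"
  have nonneg: "0 \<le> ?f k" for k
    by (auto intro!: divide_nonneg_nonneg mult_nonneg_nonneg harm_nonneg)
  then show "0 \<le> ?f k" for k .
  have "(\<integral>\<^sup>+k. ennreal (?f k) \<partial>count_space UNIV) = (\<Sum>k\<in>{1..m}. ennreal (?f k))"
    by (rule nn_integral_count_space') auto
  also have "\<dots> = ennreal (\<Sum>k\<in>{1..m}. ?f k)"
    by (rule sum_ennreal) (rule nonneg)
  also have "(\<Sum>k\<in>{1..m}. ?f k) = 1"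
    using right_zipf_sum[OF assms] by simp
  finally show "(\<integral>\<^sup>+k. ennreal (?f k) \<partial>count_space UNIV) = 1"
    by simp
qed

lemma set_pmf_right_zipf:
  assumes "m \<ge> 1"
  shows "set_pmf (right_zipf m) = {1..m}"
proof -
  have "harm m \<noteq> (0::real)"
    using harm_pos[of m, where 'a = real] assms by linarith
  then show ?thesis
    by (auto simp: set_pmf_eq pmf_right_zipf[OF assms])
qed

definition kth_accessible :: "nat \<Rightarrow> nat set \<Rightarrow> nat \<Rightarrow> nat" where
  "kth_accessible n S k = sorted_list_of_set (accessible n S) ! (k - 1)"

lemma kth_accessible_mem:
  assumes "k \<in> {1..card (accessible n S)}"
  shows "kth_accessible n S k \<in> accessible n S"
proof -
  have "kth_accessible n S k \<in> set (sorted_list_of_set (accessible n S))"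
    unfolding kth_accessible_def using assms by (intro nth_mem) auto
  then show ?thesis by simp
qed

text \<open>
  \<open>final_seating n S\<close> is the distribution of the set of seats occupied at the end of the
  process in a row of \<open>n\<close> seats, when the seats in \<open>S\<close> are occupied at the start.
\<close>

function final_seating :: "nat \<Rightarrow> nat set \<Rightarrow> nat set pmf" where
  "final_seating n S =
     (if accessible n S = {} then return_pmf S
      else bind_pmf (right_zipf (card (accessible n S)))
             (\<lambda>k. final_seating n (insert (kth_accessible n S k) S)))"
  by pat_completeness auto
termination
proof (relation "Wellfounded.measure (\<lambda>(n, S). card (accessible n S))", goal_cases)
  case 1
  show ?case by simp
next
  case (2 n S k)
  have "card (accessible n S) \<ge> 1"
    using 2(1) by (simp add: Suc_le_eq card_gt_0_iff)
  then have mem: "kth_accessible n S k \<in> accessible n S"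
    using 2(2) by (intro kth_accessible_mem) (simp add: set_pmf_right_zipf)
  have "accessible n (insert (kth_accessible n S k) S) \<subset> accessible n S"
    using mem by (auto simp: accessible_def)
  then show ?case
    by (simp add: psubset_card_mono)
qed

declare final_seating.simps [simp del]

definition expected_occupied :: "nat \<Rightarrow> real" where
  "expected_occupied n = measure_pmf.expectation (final_seating n {}) (\<lambda>S. real (card S))"

end

theory Submission
  imports Defs
begin

text \<open>
  Only the seats in front of the last occupied one stay accessible, so the expected number \<open>E m\<close>
  of further arrivals with \<open>m\<close> accessible seats satisfies
  \<open>E m = 1 + (\<Sum>j=1..m. E (m - j) / j) / H\<^sub>m\<close>. The identity
  \<open>(\<Sum>j=1..m. (H\<^sub>m - H\<^sub>m\<^sub>-\<^sub>j) / j) = (\<Sum>k=1..m. 1 / k\<^sup>2)\<close>, whose right-hand side lies in \<open>[1, 2]\<close>,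
  shows that \<open>H\<^sub>m\<^sup>2\<close> exceeds its own average under the jump distribution by something in \<open>[1, 4]\<close>.
  Hence \<open>H\<^sub>m\<^sup>2\<close> is a supersolution and \<open>H\<^sub>m\<^sup>2 / 4\<close> a subsolution of the recursion.
\<close>

text \<open>By induction: passing from \<open>m\<close> to \<open>Suc m\<close> lowers the
  \<open>j\<close>-th summand by 1/((m+1)(m+1-j)), by partial fractions. These losses total
  \<open>harm m / (m + 1)\<close>, the new summand is \<open>harm (Suc m) / (m + 1)\<close>, and the
  difference is 1/(m+1)^2.\<close>

lemma sum_harm_diff_divide:
  "(\<Sum>j=1..m. (harm m - harm (m - j)) / real j) = (\<Sum>k=1..m. 1 / (real k)\<^sup>2)"
proof (induction m)
  case (Suc m)
  have step: "(harm (Suc m) - harm (Suc m - j)) / real j =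
      (harm m - harm (m - j)) / real j - 1 / ((real m + 1) * real (m + 1 - j))"
    if "j \<in> {1..m}" for j
  proof -
    have "harm (Suc m - j) = harm (m - j) + 1 / real (m + 1 - j)"
      using that by (simp add: Suc_diff_le harm_Suc inverse_eq_divide)
    moreover have "(1 / (real m + 1) - 1 / (real m + 1 - real j)) / real j =
        - 1 / ((real m + 1) * (real m + 1 - real j))"
      using that by (simp add: divide_simps)
    ultimately show ?thesis
      using that by (simp add: harm_Suc inverse_eq_divide of_nat_diff diff_divide_distrib
          add_divide_distrib add_ac)
  qed
  have rev: "(\<Sum>j=1..m. 1 / ((real m + 1) * real (m + 1 - j))) = harm m / (real m + 1)"
    unfolding harm_def sum_divide_distrib
    by (rule sum.reindex_bij_witness[of _ "\<lambda>k. m + 1 - k" "\<lambda>k. m + 1 - k"])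
       (auto simp: inverse_eq_divide mult.commute)
  have "(\<Sum>j=1..Suc m. (harm (Suc m) - harm (Suc m - j)) / real j) =
      (\<Sum>j=1..m. (harm m - harm (m - j)) / real j) - harm m / (real m + 1)
        + harm (Suc m) / (real m + 1)"
    using rev by (simp add: step sum_subtractf harm_expand(1) add_ac)
  then show ?case
    using Suc.IH
    by (simp add: harm_Suc inverse_eq_divide add_divide_distrib power2_eq_square add_ac)
qed simp

text \<open>Telescoping; the term \<open>- 1 / real m\<close> is what lets the induction
  close.\<close>

lemma sum_inverse_squares_le: "m \<ge> 1 \<Longrightarrow> (\<Sum>k=1..m. 1 / (real k)\<^sup>2) \<le> 2 - 1 / real m"
proof (induction m rule: dec_induct)
  case (step m)
  have "1 / (real (Suc m))\<^sup>2 \<le> 1 / (real m * real (Suc m))"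
    using step.hyps by (intro divide_left_mono) (auto simp: power2_eq_square)
  also have "\<dots> = 1 / real m - 1 / real (Suc m)"
    using step.hyps by (simp add: field_simps)
  finally show ?case
    using step.IH by simp
qed simp

text \<open>Taking label \<open>k\<close> leaves \<open>k - 1\<close> accessible seats, so
  \<open>D\<close> is the expected drop of the squared harmonic number in one arrival. Factoring H^2
  - h^2 = (H - h)(H + h) with (H + h)/H in [1, 2] places \<open>D\<close> between \<open>?T\<close>
  and \<open>2 * ?T\<close>.\<close>

lemma harm_sq_minus_zipf_average:
  assumes "m \<ge> 1"
  defines "D \<equiv> (harm m)\<^sup>2 -
    (\<Sum>k=1..m. 1 / ((real m + 1 - real k) * harm m) * (harm (k - 1))\<^sup>2)"
  shows "1 \<le> D" "D \<le> 4"
proof -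
  let ?H = "harm m :: real"
  let ?T = "\<Sum>k=1..m. 1 / (real k)\<^sup>2"
  have H: "?H > 0"
    using assms(1) by (simp add: harm_pos)
  \<comment> \<open>The substitution \<open>j = m + 1 - k\<close> counts seats from the far end,
    where the right-biased weights become proportional to 1/j.\<close>
  have T: "(\<Sum>k=1..m. (?H - harm (k - 1)) / (real m + 1 - real k)) = ?T"
    unfolding sum_harm_diff_divide[symmetric]
    by (rule sum.reindex_bij_witness[of _ "\<lambda>k. m + 1 - k" "\<lambda>k. m + 1 - k"])
       (auto simp: of_nat_diff)
  \<comment> \<open>The weights sum to 1, so the constant can be moved inside the average.\<close>
  have "?H\<^sup>2 = (\<Sum>k=1..m. 1 / ((real m + 1 - real k) * ?H)) * ?H\<^sup>2"
    by (simp only: right_zipf_sum[OF assms(1)] mult_1)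
  then have D: "D = (\<Sum>k=1..m. 1 / ((real m + 1 - real k) * ?H) * (?H\<^sup>2 - (harm (k - 1))\<^sup>2))"
    unfolding D_def by (simp add: sum_distrib_right right_diff_distrib sum_subtractf)
  have bounds:
    "(?H - harm (k - 1)) / (real m + 1 - real k) \<le>
       1 / ((real m + 1 - real k) * ?H) * (?H\<^sup>2 - (harm (k - 1))\<^sup>2)"
    "1 / ((real m + 1 - real k) * ?H) * (?H\<^sup>2 - (harm (k - 1))\<^sup>2) \<le>
       2 * ((?H - harm (k - 1)) / (real m + 1 - real k))" if "k \<in> {1..m}" for k
  proof -
    let ?h = "harm (k - 1) :: real"
    let ?a = "(?H - ?h) / (real m + 1 - real k)"
    let ?b = "1 / ((real m + 1 - real k) * ?H) * (?H\<^sup>2 - ?h\<^sup>2)"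
    have h: "0 \<le> ?h" "?h \<le> ?H"
      using that by (auto intro!: harm_nonneg harm_mono)
    have b: "?b = ?a * ((?H + ?h) / ?H)"
      by (simp add: power2_eq_square square_diff_square_factored)
    have a: "?a \<ge> 0"
      using that h by auto
    have "1 \<le> (?H + ?h) / ?H" "(?H + ?h) / ?H \<le> 2"
      using h H by (auto simp: field_simps)
    then show "?a \<le> ?b" "?b \<le> 2 * ?a"
      unfolding b using a mult_left_mono[of 1 "(?H + ?h) / ?H" ?a]
        mult_left_mono[of "(?H + ?h) / ?H" 2 ?a] by (auto simp: mult.commute)
  qed
  have "?T \<le> D"
    unfolding D T[symmetric] by (intro sum_mono bounds)
  moreover have "1 \<le> ?T"
    using assms(1) member_le_sum[of 1 "{1..m}" "\<lambda>k. 1 / (real k)\<^sup>2"] by simp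
  ultimately show "1 \<le> D" by simp
  have "D \<le> 2 * ?T"
    unfolding D T[symmetric] sum_distrib_left by (intro sum_mono bounds)
  moreover have "?T \<le> 2"
    using sum_inverse_squares_le[OF assms(1)] by (rule order_trans) simp
  ultimately show "D \<le> 4" by simp
qed

text \<open>Accessible seats remain an initial interval, so the recursion needs only their
  number.\<close>

lemma accessible_insert:
  assumes "accessible n S = {1..m}" "k \<in> {1..m}"
  shows "accessible n (insert k S) = {1..k - 1}"
proof -
  have "accessible n (insert k S) = accessible n S \<inter> {..<k}"
    by (auto simp: accessible_def)
  then show ?thesis
    using assms by auto
qed

lemma kth_accessible_interval:
  assumes "accessible n S = {1..m}" "k \<in> {1..m}"
  shows "kth_accessible n S k = k"
proof -
  have "sorted_list_of_set {1..m} = [1..<Suc m]"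
    by (simp flip: atLeastLessThanSuc_atLeastAtMost del: upt_Suc)
  then show ?thesis
    using assms by (simp add: kth_accessible_def nth_upt del: upt_Suc)
qed

lemma final_seating_step:
  assumes "accessible n S = {1..m}" "m \<ge> 1"
  shows "final_seating n S = bind_pmf (right_zipf m) (\<lambda>k. final_seating n (insert k S))"
proof -
  have "final_seating n S =
      bind_pmf (right_zipf m) (\<lambda>k. final_seating n (insert (kth_accessible n S k) S))"
    using assms by (subst final_seating.simps) simp
  also have "\<dots> = bind_pmf (right_zipf m) (\<lambda>k. final_seating n (insert k S))"
    using assms by (intro bind_pmf_cong) (auto simp: set_pmf_right_zipf kth_accessible_interval)
  finally show ?thesis .
qed

text \<open>Finite support allows the expectation of a bind to be expanded as a finite weighted
  sum.\<close>

lemma finite_set_pmf_final_seating: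
  "accessible n S = {1..m} \<Longrightarrow> finite (set_pmf (final_seating n S))"
proof (induction m arbitrary: S rule: less_induct)
  case (less m)
  show ?case
  proof (cases "m = 0")
    case True
    then show ?thesis
      using less.prems by (simp add: final_seating.simps)
  next
    case False
    have "finite (set_pmf (final_seating n (insert k S)))" if "k \<in> {1..m}" for k
      using that by (intro less.IH[OF _ accessible_insert[OF less.prems that]]) auto
    then show ?thesis
      using False by (simp add: final_seating_step[OF less.prems] set_pmf_right_zipf)
  qed
qed

lemma expectation_final_seating_step:
  assumes "accessible n S = {1..m}" "m \<ge> 1"
  shows "measure_pmf.expectation (final_seating n S) f =
    (\<Sum>k=1..m. 1 / ((real m + 1 - real k) * harm m) *
       measure_pmf.expectation (final_seating n (insert k S)) (f :: _ \<Rightarrow> real))"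
proof -
  have "measure_pmf.expectation (final_seating n S) f =
    (\<Sum>k=1..m. pmf (right_zipf m) k *\<^sub>R
       measure_pmf.expectation (final_seating n (insert k S)) f)"
    unfolding final_seating_step[OF assms]
    using assms accessible_insert[OF assms(1)]
    by (intro pmf_expectation_bind)
       (auto simp: set_pmf_right_zipf intro: finite_set_pmf_final_seating)
  then show ?thesis
    using assms(2) by (simp add: pmf_right_zipf)
qed

text \<open>Strong induction over all \<open>S\<close> with \<open>m\<close> accessible seats;
  \<open>card S\<close> accounts for those already seated, and each arrival adds 1.\<close>

lemma expectation_card_final_seating_bounds:
  assumes "accessible n S = {1..m}" "finite S"
  defines "E \<equiv> \<lambda>S. measure_pmf.expectation (final_seating n S) (\<lambda>S. real (card S))"
  shows "real (card S) + (harm m)\<^sup>2 / 4 \<le> E S \<and> E S \<le> real (card S) + (harm m)\<^sup>2"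
  using assms(1,2)
proof (induction m arbitrary: S rule: less_induct)
  case (less m)
  show ?case
  proof (cases "m = 0")
    case True
    then show ?thesis
      using less.prems by (simp add: E_def final_seating.simps harm_expand)
  next
    case False
    then have m: "m \<ge> 1" by simp
    define w where "w k = 1 / ((real m + 1 - real k) * harm m)" for k
    define A where "A = (\<Sum>k=1..m. w k * (harm (k - 1))\<^sup>2)"
    have w: "w k \<ge> 0" if "k \<in> {1..m}" for k
      using that by (auto simp: w_def intro!: mult_nonneg_nonneg harm_nonneg)
    have w1: "(\<Sum>k=1..m. w k) = 1"
      unfolding w_def by (rule right_zipf_sum[OF m])
    have E: "E S = (\<Sum>k=1..m. w k * E (insert k S))"
      unfolding E_def w_def by (rule expectation_final_seating_step[OF less.prems(1) m])
    have IH: "real (card S) + 1 + (harm (k - 1))\<^sup>2 / 4 \<le> E (insert k S)"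
             "E (insert k S) \<le> real (card S) + 1 + (harm (k - 1))\<^sup>2" if "k \<in> {1..m}" for k
    proof -
      have "k \<notin> S"
        using that less.prems(1) by (auto simp: accessible_def)
      then have "real (card (insert k S)) = real (card S) + 1"
        using less.prems(2) by simp
      then show "real (card S) + 1 + (harm (k - 1))\<^sup>2 / 4 \<le> E (insert k S)"
             "E (insert k S) \<le> real (card S) + 1 + (harm (k - 1))\<^sup>2"
        using less.IH[OF _ accessible_insert[OF less.prems(1) that]] that less.prems(2) by auto
    qed
    have D: "1 \<le> (harm m)\<^sup>2 - A" "(harm m)\<^sup>2 - A \<le> 4"
      unfolding A_def w_def by (rule harm_sq_minus_zipf_average[OF m])+
    \<comment> \<open>Applied with \<open>c = 1/4\<close> for the lower bound and
      \<open>c = 1\<close> for the upper one.\<close>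
    have sum_w: "(\<Sum>k=1..m. w k * (real (card S) + 1 + c * (harm (k - 1))\<^sup>2)) =
        real (card S) + 1 + c * A" for c
    proof -
      have "(\<Sum>k=1..m. w k * (real (card S) + 1 + c * (harm (k - 1))\<^sup>2)) =
          (\<Sum>k=1..m. w k) * (real (card S) + 1) + c * A"
        unfolding A_def sum_distrib_left sum_distrib_right sum.distrib[symmetric]
        by (intro sum.cong) (auto simp: algebra_simps)
      then show ?thesis
        by (simp only: w1 mult_1)
    qed
    have "real (card S) + 1 + 1/4 * A \<le> E S"
      unfolding E sum_w[symmetric] using IH(1) w by (intro sum_mono mult_left_mono) auto
    moreover have "E S \<le> real (card S) + 1 + 1 * A"
      unfolding E sum_w[symmetric] using IH(2) w by (intro sum_mono mult_left_mono) auto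
    \<comment> \<open>\<open>D\<close> gives 1 + A/4 >= H^2/4 from its upper bound and 1 + A <= H^2
      from its lower bound.\<close>
    ultimately show ?thesis
      using D by simp
  qed
qed

lemma expected_occupied_bounds:
  "(harm n)\<^sup>2 / 4 \<le> expected_occupied n" "expected_occupied n \<le> (harm n)\<^sup>2"
proof -
  have "accessible n {} = {1..n}"
    by (auto simp: accessible_def)
  then show "(harm n)\<^sup>2 / 4 \<le> expected_occupied n" "expected_occupied n \<le> (harm n)\<^sup>2"
    using expectation_card_final_seating_bounds[of n "{}" n]
    by (simp_all add: expected_occupied_def)
qed

theorem theorem8:
  shows "expected_occupied \<in> \<Theta>(\<lambda>n. (ln (real n))\<^sup>2)"
proof (rule bigthetaI)
  have nonneg: "expected_occupied n \<ge> 0" for n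
    using expected_occupied_bounds(1)[of n] by (rule order_trans[rotated]) simp
  show "expected_occupied \<in> O(\<lambda>n. (ln (real n))\<^sup>2)"
  proof (rule bigoI[where c = 4], rule eventually_sequentiallyI)
    fix n :: nat
    assume n: "3 \<le> n"
    have "exp 1 \<le> real n"
      using exp_le n by linarith
    then have "1 \<le> ln (real n)"
      using n by (subst ln_ge_iff) auto
    \<comment> \<open>The difference H_n - ln n is at most its value 1 at n = 1, and
      \<open>3 \<le> n\<close> ensures that ln n absorbs this 1.\<close>
    then have "harm n \<le> 2 * ln (real n)"
      using euler_mascheroni_sequence_decreasing[of 1 n] n by (simp add: harm_expand)
    then have "(harm n)\<^sup>2 \<le> (2 * ln (real n))\<^sup>2"
      by (intro power_mono harm_nonneg)
    then show "norm (expected_occupied n) \<le> 4 * norm ((ln (real n))\<^sup>2)"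
      using expected_occupied_bounds(2)[of n] nonneg[of n] by (simp add: power_mult_distrib)
  qed
  show "expected_occupied \<in> \<Omega>(\<lambda>n. (ln (real n))\<^sup>2)"
  proof (rule landau_omega.bigI[where c = "1/4"], simp, rule eventually_sequentiallyI)
    fix n :: nat
    assume n: "1 \<le> n"
    have "ln (real n) \<le> ln (real n + 1)"
      using n by simp
    also have "\<dots> \<le> harm n"
      by (rule ln_le_harm)
    \<comment> \<open>Squaring preserves the inequality because \<open>1 \<le> n\<close> makes the
      logarithm nonnegative.\<close>
    finally have "(ln (real n))\<^sup>2 \<le> (harm n)\<^sup>2"
      using n by (intro power_mono) auto
    then show "1 / 4 * norm ((ln (real n))\<^sup>2) \<le> norm (expected_occupied n)"
      using expected_occupied_bounds(1)[of n] nonneg[of n] by simp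
  qed
qed

end
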